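(* Let $\alpha\in\mathbb{N}$ and let $k^t,k^d\in\mathbb{N}$ satisfy $k^t\ge\left\lceil\frac{\alpha k^d}{k^t}\right\rceil$. There is an instance $I$ of the relief distribution problem with $k^t$ trucks, $k^d$ drones and drone speed $\alpha$ such that $$\frac{\mathrm{Regretless}(I)}{\mathrm{OPT}(I^* )}=1+\left\lceil\frac{\alpha k^d}{k^t}\right\rceil.$$
   Context: Relief distribution problem (RDP). $\mathbb{N}=\{1,2,\dots\}$. An instance is $I=(k^t,k^d,\alpha,G,D)$: $k^t,k^d\in\mathbb{N}$ are the numbers of trucks and drones; $\alpha>0$ is the drone speed; $G=(V,E,c)$ is a finite connected undirected graph (not necessarily complete) with $V=\{v_0\}\cup C$, where $v_0$ is the depot and $C\neq\emptyset$ is the set of non-depot nodes; edge lengths $c(i,j)>0$ satisfy the triangle inequality; $D\subseteq C$ is the set of damaged nodes, initially unknown; the status of a node is revealed (instantly to all) when some vehicle first arrives at it. For non-adjacent $i,j$, $c(i,j)$ is the shortest-path distance. A truck needs time $c(i,j)$ to traverse an edge, a drone needs $\frac1\alpha c(i,j)$. A tour is a closed walk in $G$ starting and ending at $v_0$ (possibly of length $0$); it may be written as a sequence of nodes, consecutive nodes being joined by shortest paths, and $c(t)$ is the length of tour $t$. The makespan of a family of tours is the maximum duration of a tour. Full-information optimum: $\mathrm{OPT}(I^* )$ is the minimum makespan over all families of $k^t$ truck tours and $k^d$ drone tours such that every node of $C$ is visited by some vehicle and every node of $D$ is visited by a truck ($I^*$ is the instance $I$ with $D$ known in advance). For integers $m,n\ge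 0$ with $m+n\ge1$ and $W\subseteq C$, $S^*_{m,n}(W)$ denotes a family of $m$ truck tours and $n$ drone tours together visiting all nodes of $W$ with minimum makespan. Policy Regretless (deterministic; choices among optimal solutions are made by a fixed rule using only the information available at that time, so first-stage decisions do not depend on $D$). First stage: compute $S^*_{k^t,0}(C)=\{s^*_1,\dots,s^*_{k^t}\}$, written as $s^*_i=(v_0,v_{(1)},\dots,v_{(n_i)},v_0)$ so that each node of $C$ is listed exactly once in exactly one tour. Assign one truck to each tour and distribute the drones as evenly as possible, so each tour receives $\lceil k^d/k^t\rceil$ or $\lfloor k^d/k^t\rfloor$ drones; let $k_i$ be the number of vehicles assigned to $s_i^*$. Split $(v_{(1)},\dots,v_{(n_i)})$ into up to $k_i$ consecutive nonempty segments $\Delta_i^l=(v_{(j_l)},\dots,v_{(j_{l+1}-1)})$, $j_1=1$; the truck is assigned the tour $t_i^1=(v_0,v_{(1)},\dots,v_{(j_2-1)},v_0)$ and each further segment $l\ge2$ is assigned to one drone, with the reversed tour $t_i^l=(v_0,v_{(j_{l+1}-1)},\dots,v_{(j_l)},v_0)$; the splitting is chosen to minimize $\max\{c(t_i^1),\max_{l\ge2} c(t_i^l)/\alpha\}$. All vehicles start at time $0$. Second stage (replanning), for each $i$: when truck $i$ reaches the last node $v_{(j_2-1)}$ of its segment, let $D_i^d$ be the set of damaged nodes of $s_i^*$ not yet visited by the truck and $C_i^d$ the set of nodes of $s_i^*$ not yet visited by any vehicle; the truck then follows a minimum-length walk from its current node visiting all of $D_i^d\cup C_i^d$ and ending at $v_0$.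 The drones complete their tours. $\mathrm{Regretless}(I)$ is the time at which the last vehicle has returned to $v_0$. *)

theory Defs
  imports "Graph_Theory.Graph_Theory"
begin

section \<open>Instances\<close>

text \<open>
  An instance consists of a network (everything that is known in advance) and the set \<open>D\<close> of
  damaged nodes, which is kept separate so that first-stage decisions can be typed as functions of
  the network alone. Undirected graphs are symmetric digraphs, as usual in Graph\_Theory, and
  walks are lists of arcs.
\<close>

type_synonym 'v walk = "('v \<times> 'v) awalk"

record 'v network =
  trucks :: nat
  drones :: nat
  speed :: real
  roads :: "'v pair_pre_digraph"
  depot :: 'v
  len :: "('v \<times> 'v) weight_fun"

abbreviation nodes :: "'v network \<Rightarrow> 'v set" where
  "nodes N \<equiv> pverts (roads N)"

abbreviation clients :: "'v network \<Rightarrow> 'v set" where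
  "clients N \<equiv> nodes N - {depot N}"

abbreviation is_walk :: "'v network \<Rightarrow> 'v \<Rightarrow> 'v walk \<Rightarrow> 'v \<Rightarrow> bool" where
  "is_walk N \<equiv> pre_digraph.awalk (with_proj (roads N))"

abbreviation cost :: "'v network \<Rightarrow> 'v walk \<Rightarrow> real" where
  "cost N \<equiv> wf_digraph.awalk_cost (len N)"

abbreviation shortest_dist :: "'v network \<Rightarrow> 'v \<Rightarrow> 'v \<Rightarrow> ereal" where
  "shortest_dist N \<equiv> wf_digraph.\<mu> (with_proj (roads N)) (len N)"

text \<open>The edge lengths, extended to all pairs of nodes.\<close>

definition ext_len :: "'v network \<Rightarrow> 'v \<Rightarrow> 'v \<Rightarrow> real" where
  "ext_len N u v =
     (if (u, v) \<in> parcs (roads N) then len N (u, v) else real_of_ereal (shortest_dist N u v))"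

definition rdp_network :: "'v network \<Rightarrow> bool" where
  "rdp_network N \<longleftrightarrow>
     trucks N \<ge> 1 \<and> drones N \<ge> 1 \<and> speed N > 0 \<and>
     pair_graph (roads N) \<and> connected (with_proj (roads N)) \<and>
     depot N \<in> nodes N \<and> clients N \<noteq> {} \<and>
     (\<forall>u v. (u, v) \<in> parcs (roads N) \<longrightarrow> len N (u, v) > 0 \<and> len N (u, v) = len N (v, u)) \<and>
     (\<forall>u \<in> nodes N. \<forall>v \<in> nodes N. \<forall>w \<in> nodes N. ext_len N u w \<le> ext_len N u v + ext_len N v w)"

definition rdp_instance :: "'v network \<Rightarrow> 'v set \<Rightarrow> bool" where
  "rdp_instance N D \<longleftrightarrow> rdp_network N \<and> D \<subseteq> clients N"


section \<open>Families of tours and the full-information optimum\<close>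

abbreviation is_tour :: "'v network \<Rightarrow> 'v walk \<Rightarrow> bool" where
  "is_tour N p \<equiv> is_walk N (depot N) p (depot N)"

definition visits :: "'v network \<Rightarrow> 'v walk list \<Rightarrow> 'v set" where
  "visits N ps = (\<Union>p \<in> set ps. set (pawalk_verts (depot N) p))"

definition makespan :: "'v network \<Rightarrow> 'v walk list \<Rightarrow> 'v walk list \<Rightarrow> real" where
  "makespan N ts ds = Max (set (map (cost N) ts @ map (\<lambda>p. cost N p / speed N) ds))"

definition tour_family ::
  "'v network \<Rightarrow> nat \<Rightarrow> nat \<Rightarrow> 'v set \<Rightarrow> 'v walk list \<Rightarrow> 'v walk list \<Rightarrow> bool" where
  "tour_family N m n W ts ds \<longleftrightarrow>
     length ts = m \<and> length ds = n \<and> (\<forall>p \<in> set (ts @ ds). is_tour N p) \<and> W \<subseteq> visits N (ts @ ds)"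

text \<open>\<open>(ts, ds)\<close> is a possible choice of \<open>S\<^sup>*\<^bsub>m,n\<^esub>(W)\<close>.\<close>

definition optimal_family ::
  "'v network \<Rightarrow> nat \<Rightarrow> nat \<Rightarrow> 'v set \<Rightarrow> 'v walk list \<Rightarrow> 'v walk list \<Rightarrow> bool" where
  "optimal_family N m n W ts ds \<longleftrightarrow>
     tour_family N m n W ts ds \<and>
     (\<forall>ts' ds'. tour_family N m n W ts' ds' \<longrightarrow> makespan N ts ds \<le> makespan N ts' ds')"

definition OPT :: "'v network \<Rightarrow> 'v set \<Rightarrow> real" where
  "OPT N D =
     (LEAST T. \<exists>ts ds. tour_family N (trucks N) (drones N) (clients N) ts ds \<and>
        D \<subseteq> visits N ts \<and> T = makespan N ts ds)"


section \<open>First stage of Regretless\<close>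

text \<open>The walk \<open>p\<close> follows a sequence of nodes, joining consecutive nodes by shortest paths.\<close>

fun follows :: "'v network \<Rightarrow> 'v list \<Rightarrow> 'v walk \<Rightarrow> bool" where
  "follows N (u # v # xs) p \<longleftrightarrow>
     (\<exists>q r. p = q @ r \<and> is_walk N u q v \<and> ereal (cost N q) = shortest_dist N u v \<and>
        follows N (v # xs) r)"
| "follows N _ p \<longleftrightarrow> p = []"

text \<open>The length \<open>c(t)\<close> of the tour \<open>t\<close> written as \<open>(v\<^sub>0, xs, v\<^sub>0)\<close>.\<close>

definition tour_length :: "'v network \<Rightarrow> 'v list \<Rightarrow> real" where
  "tour_length N xs =
     sum_list (map2 (ext_len N) (depot N # xs) (xs @ [depot N]))"

text \<open>
  Splittings of the node sequence of a tour. The first segment belongs to the truck, the others to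
  drones. The splitting has no segments, and the truck stays at the depot, if and only if the
  sequence is empty.
\<close>

definition splitting :: "'v list \<Rightarrow> nat \<Rightarrow> 'v list list \<Rightarrow> bool" where
  "splitting xs k ss \<longleftrightarrow> concat ss = xs \<and> [] \<notin> set ss \<and> length ss \<le> k"

definition truck_segment :: "'v list list \<Rightarrow> 'v list" where
  "truck_segment ss = (case ss of [] \<Rightarrow> [] | s # _ \<Rightarrow> s)"

definition drone_segments :: "'v list list \<Rightarrow> 'v list list" where
  "drone_segments ss = tl ss"

definition splitting_value :: "'v network \<Rightarrow> 'v list list \<Rightarrow> real" where
  "splitting_value N ss =
     Max (set (tour_length N (truck_segment ss) #
       map (\<lambda>s. tour_length N (rev s) / speed N) (drone_segments ss)))"

definition optimal_splitting :: "'v network \<Rightarrow> 'v list \<Rightarrow> nat \<Rightarrow> 'v list list \<Rightarrow> bool" where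
  "optimal_splitting N xs k ss \<longleftrightarrow>
     splitting xs k ss \<and>
     (\<forall>ss'. splitting xs k ss' \<longrightarrow> splitting_value N ss \<le> splitting_value N ss')"

text \<open>
  Tours are indexed by \<open>i < trucks N\<close>, and truck \<open>i\<close> is the one assigned to tour \<open>i\<close>. The node
  sequence \<open>listing P i\<close> omits the depot at both ends. \<open>truck_route P i\<close> only extends to
  the last node of the truck's segment, because the way back is replanned there. Drones
  that receive no segment stay at the depot and do not occur in \<open>drone_routes\<close>.
\<close>

record 'v plan =
  base_tours :: "'v walk list"
  listing :: "nat \<Rightarrow> 'v list"
  drone_count :: "nat \<Rightarrow> nat"
  segments :: "nat \<Rightarrow> 'v list list"
  truck_route :: "nat \<Rightarrow> 'v walk"
  drone_routes :: "nat \<Rightarrow> 'v walk list"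

definition first_stage_plan :: "'v network \<Rightarrow> 'v plan \<Rightarrow> bool" where
  "first_stage_plan N P \<longleftrightarrow>
     optimal_family N (trucks N) 0 (clients N) (base_tours P) [] \<and>
     (let all = concat (map (listing P) [0..<trucks N]) in distinct all \<and> set all = clients N) \<and>
     (\<Sum>i<trucks N. drone_count P i) = drones N \<and>
     (\<forall>i<trucks N.
        follows N (depot N # listing P i @ [depot N]) (base_tours P ! i) \<and>
        int (drone_count P i) \<in> {\<lceil>real (drones N) / real (trucks N)\<rceil>,
                                 \<lfloor>real (drones N) / real (trucks N)\<rfloor>} \<and>
        optimal_splitting N (listing P i) (1 + drone_count P i) (segments P i) \<and>
        follows N (depot N # truck_segment (segments P i)) (truck_route P i) \<and>
        list_all2 (\<lambda>s p. follows N (depot N # rev s @ [depot N]) p)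
          (drone_segments (segments P i)) (drone_routes P i))"


section \<open>Second stage and the policy\<close>

text \<open>
  A policy fixes all choices: \<open>plan_of R N\<close> is the first-stage plan, and \<open>return_of R N D i\<close>
  is the walk of truck \<open>i\<close> from the last node of its segment back to the depot. The latter may
  depend on \<open>D\<close> only through the information available when the replanning takes place; see
  \<open>regretless_policy\<close> below.
\<close>

record 'v policy =
  plan_of :: "'v network \<Rightarrow> 'v plan"
  return_of :: "'v network \<Rightarrow> 'v set \<Rightarrow> nat \<Rightarrow> 'v walk"

definition truck_walk :: "'v policy \<Rightarrow> 'v network \<Rightarrow> 'v set \<Rightarrow> nat \<Rightarrow> 'v walk" where
  "truck_walk R N D i = truck_route (plan_of R N) i @ return_of R N D i"

definition replan_node :: "'v policy \<Rightarrow> 'v network \<Rightarrow> nat \<Rightarrow> 'v" where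
  "replan_node R N i = last (depot N # truck_segment (segments (plan_of R N) i))"

definition replan_time :: "'v policy \<Rightarrow> 'v network \<Rightarrow> nat \<Rightarrow> real" where
  "replan_time R N i = cost N (truck_route (plan_of R N) i)"

text \<open>Nodes reached by time \<open>\<tau>\<close> when the walk \<open>p\<close> is started at the depot at time 0 with speed \<open>s\<close>.\<close>

definition reached :: "'v network \<Rightarrow> real \<Rightarrow> 'v walk \<Rightarrow> real \<Rightarrow> 'v set" where
  "reached N s p \<tau> =
     {pawalk_verts (depot N) p ! j | j. j \<le> length p \<and> cost N (take j p) / s \<le> \<tau>}"

definition reached_by_any :: "'v policy \<Rightarrow> 'v network \<Rightarrow> 'v set \<Rightarrow> real \<Rightarrow> 'v set" where
  "reached_by_any R N D \<tau> =
     (\<Union>i<trucks N. reached N 1 (truck_walk R N D i) \<tau> \<union>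
        (\<Union>p \<in> set (drone_routes (plan_of R N) i). reached N (speed N) p \<tau>))"

text \<open>\<open>D\<^sub>i\<^sup>d\<close> and \<open>C\<^sub>i\<^sup>d\<close>.\<close>

definition open_damaged :: "'v policy \<Rightarrow> 'v network \<Rightarrow> 'v set \<Rightarrow> nat \<Rightarrow> 'v set" where
  "open_damaged R N D i =
     (D \<inter> set (listing (plan_of R N) i)) - reached N 1 (truck_walk R N D i) (replan_time R N i)"

definition open_clients :: "'v policy \<Rightarrow> 'v network \<Rightarrow> 'v set \<Rightarrow> nat \<Rightarrow> 'v set" where
  "open_clients R N D i =
     set (listing (plan_of R N) i) - reached_by_any R N D (replan_time R N i)"

definition return_walk :: "'v network \<Rightarrow> 'v \<Rightarrow> 'v set \<Rightarrow> 'v walk \<Rightarrow> bool" where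
  "return_walk N u X p \<longleftrightarrow> is_walk N u p (depot N) \<and> X \<subseteq> set (pawalk_verts u p)"

definition shortest_return_walk :: "'v network \<Rightarrow> 'v \<Rightarrow> 'v set \<Rightarrow> 'v walk \<Rightarrow> bool" where
  "shortest_return_walk N u X p \<longleftrightarrow>
     return_walk N u X p \<and> (\<forall>q. return_walk N u X q \<longrightarrow> cost N p \<le> cost N q)"

text \<open>
  The last condition says that replanning is non-anticipative: two damage sets that agree on the
  nodes whose status has been revealed by the time of replanning lead to the same decision.
  The recursion in the definition of the sets to be visited is harmless: what has been reached
  by the replanning time of truck \<open>i\<close> depends only on decisions taken at strictly earlier times,
  because edge lengths are positive.
\<close>

definition regretless_policy :: "'v policy \<Rightarrow> bool" where
  "regretless_policy R \<longleftrightarrow>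
     (\<forall>N. rdp_network N \<longrightarrow> first_stage_plan N (plan_of R N)) \<and>
     (\<forall>N D. rdp_instance N D \<longrightarrow>
        (\<forall>i<trucks N. shortest_return_walk N (replan_node R N i)
           (open_damaged R N D i \<union> open_clients R N D i) (return_of R N D i))) \<and>
     (\<forall>N D D'. rdp_instance N D \<longrightarrow> rdp_instance N D' \<longrightarrow>
        (\<forall>i<trucks N.
           D \<inter> reached_by_any R N D (replan_time R N i) =
           D' \<inter> reached_by_any R N D (replan_time R N i) \<longrightarrow>
           return_of R N D i = return_of R N D' i))"

definition Regretless :: "'v policy \<Rightarrow> 'v network \<Rightarrow> 'v set \<Rightarrow> real" where
  "Regretless R N D =
     makespan N (map (truck_walk R N D) [0..<trucks N])
       (concat (map (drone_routes (plan_of R N)) [0..<trucks N]))"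

end

(*
  The network is a star with n = kt + \<alpha> kd clients at distance 1 from the depot. Put
  q = \<lceil>\<alpha> kd / kt\<rceil>. A tour has length at least twice the number of clients it visits, so the
  optimal tours by trucks alone have at most 1 + q clients each, and by the pigeonhole principle
  one of them, say tour i, has exactly 1 + q. Let D consist of all clients of tour i but the
  first. Since the first client always belongs to the truck's segment, the truck has to visit
  every client of tour i after replanning, and Regretless takes time 2 (1 + q). With full
  information, the at most q \<le> kt damaged clients are visited by different trucks, one client per
  truck and \<alpha> clients per drone, which takes time 2.
*)

theory Submission
  imports Defs
begin

section \<open>General facts on walks, blocks of lists and makespans\<close>

text \<open>Together with \<open>pcas_leaves\<close>, this provides an arc into and an arc out of
  each client on a closed walk based at the depot, which is what lower bounds on tour lengths
  count.\<close>

lemma pcas_enters: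
  assumes "pcas u p v" "x \<in> set (pawalk_verts u p)" "x \<noteq> u"
  shows "\<exists>y. (y, x) \<in> set p"
  using assms by (induction p arbitrary: u) (auto, metis prod.collapse)

lemma pcas_leaves:
  assumes "pcas u p v" "x \<in> set (pawalk_verts u p)" "x \<noteq> v"
  shows "\<exists>y. (x, y) \<in> set p"
  using assms
proof (induction p arbitrary: u)
  case (Cons e p)
  then show ?case by (cases e) auto
qed simp

text \<open>Cut \<open>xs\<close> into consecutive blocks of length \<open>m\<close>: position
  \<open>j\<close> lies in block \<open>j div m\<close> at offset \<open>j mod m\<close>. This shows
  later that handing out blocks to vehicles leaves no client unserved.\<close>

lemma nth_in_chunk:
  assumes "j < length xs" "m \<ge> 1"
  shows "xs ! j \<in> set (take m (drop (j div m * m) xs))"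
proof -
  have *: "j div m * m + j mod m = j" by simp
  have "take m (drop (j div m * m) xs) ! (j mod m) = xs ! j"
  proof -
    have "j div m * m \<le> length xs" using assms(1) * by linarith
    moreover have "j mod m < m" using assms(2) by simp
    ultimately show ?thesis by (simp only: nth_take nth_drop *)
  qed
  moreover have "j mod m < length (take m (drop (j div m * m) xs))"
    using assms * by (simp add: less_diff_conv2) (metis add.commute * div_mult_mod_eq less_diff_conv)
  ultimately show ?thesis by (metis nth_mem)
qed

text \<open>The pigeonhole principle in contrapositive form, to be applied to the listings of the
  base tours.\<close>

lemma length_concat_map_le:
  assumes "\<And>i. i < k \<Longrightarrow> length (f i) \<le> m"
  shows "length (concat (map f [0..<k])) \<le> k * m"
  using assms by (induction k) (auto intro: add_mono simp: less_Suc_eq add.commute)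

lemma makespan_le:
  assumes "ts \<noteq> []" "\<And>p. p \<in> set ts \<Longrightarrow> cost N p \<le> T"
    and "\<And>p. p \<in> set ds \<Longrightarrow> cost N p / speed N \<le> T"
  shows "makespan N ts ds \<le> T"
  unfolding makespan_def using assms by (subst Max_le_iff) auto

lemma makespan_ge:
  assumes "p \<in> set ts"
  shows "cost N p \<le> makespan N ts ds"
  unfolding makespan_def using assms by (intro Max_ge) auto

lemma follows_walk:
  assumes "pair_wf_digraph (roads N)" "follows N (u # xs) p" "u \<in> nodes N"
  shows "is_walk N u p (last (u # xs)) \<and> set (u # xs) \<subseteq> set (pawalk_verts u p)"
  using assms(2,3)
proof (induction xs arbitrary: u p)
  case Nil
  interpret pair_wf_digraph "roads N" by fact
  from Nil show ?case by (simp add: awalk_Nil_iff)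
next
  case (Cons v xs)
  interpret pair_wf_digraph "roads N" by fact
  from Cons.prems obtain q r where qr: "p = q @ r" "awalk u q v" "follows N (v # xs) r"
    by auto
  from qr(2) have "v \<in> nodes N" by auto
  from Cons.IH[OF qr(3) this] have r: "awalk v r (last (v # xs))"
      "set (v # xs) \<subseteq> set (pawalk_verts v r)" by auto
  have w: "awalk u p (last (v # xs))" using qr r by (auto intro: awalk_appendI)
  have "u \<in> set (pawalk_verts u p)" using w by (rule hd_in_awalk_verts)
  moreover have "set (pawalk_verts v r) \<subseteq> set (pawalk_verts u p)"
    using set_awalk_verts_append[OF qr(2) r(1)] qr(1) by simp
  ultimately show ?case using w r by auto
qed


section \<open>The star network with unit edge lengths\<close>

definition star :: "nat \<Rightarrow> nat pair_pre_digraph" where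
  "star n = \<lparr>pverts = {0..n}, parcs = {0} \<times> {1..n} \<union> {1..n} \<times> {0}\<rparr>"

definition star_network :: "nat \<Rightarrow> nat \<Rightarrow> nat \<Rightarrow> nat \<Rightarrow> nat network" where
  "star_network kt kd \<alpha> n =
     \<lparr>trucks = kt, drones = kd, speed = real \<alpha>, roads = star n, depot = 0, len = (\<lambda>_. 1)\<rparr>"

lemma star_network_simps [simp]:
  "trucks (star_network kt kd \<alpha> n) = kt"
  "drones (star_network kt kd \<alpha> n) = kd"
  "speed (star_network kt kd \<alpha> n) = real \<alpha>"
  "roads (star_network kt kd \<alpha> n) = star n"
  "depot (star_network kt kd \<alpha> n) = 0"
  "len (star_network kt kd \<alpha> n) = (\<lambda>_. 1)"
  by (simp_all add: star_network_def)

lemma pverts_star [simp]: "pverts (star n) = {0..n}"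
  by (simp add: star_def)

lemma arcs_star_iff [simp]:
  "(u, v) \<in> parcs (star n) \<longleftrightarrow> u = 0 \<and> 1 \<le> v \<and> v \<le> n \<or> v = 0 \<and> 1 \<le> u \<and> u \<le> n"
  by (auto simp: star_def)

interpretation star: pair_graph "star n" for n
proof (unfold_locales)
  show "finite (parcs (star n))" by (simp add: star_def)
  show "symmetric (star n)" by (auto simp: symmetric_def sym_def)
qed (auto simp: star_def)

lemma clients_star: "clients (star_network kt kd \<alpha> n) = {1..n}"
  by auto

text \<open>Unit lengths turn costs into numbers of arcs, so that most estimates below concern
  \<open>length\<close> and natural numbers.\<close>

lemma cost_star [simp]:
  fixes p :: "nat walk"
  shows "wf_digraph.awalk_cost (\<lambda>_. 1) p = real (length p)"
  by (induction p) auto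

text \<open>The centre is the only neighbour of a client \<open>x\<close>, so a tour through
  \<open>x\<close> uses both \<open>(0, x)\<close> and \<open>(x, 0)\<close>. For \<open>x\<close>
  in \<open>S\<close> these are \<open>2 * card S\<close> distinct arcs, since \<open>0\<close> is
  not in \<open>S\<close>.\<close>

lemma length_tour_ge:
  assumes "star.awalk n 0 p 0" "S \<subseteq> set (pawalk_verts 0 p)" "0 \<notin> S"
  shows "2 * card S \<le> length p"
proof -
  have cas: "pcas 0 p 0" and arcs: "set p \<subseteq> parcs (star n)" using assms(1) by auto
  have fin: "finite S" using assms(2) finite_subset by blast
  have "(0, x) \<in> set p" if x: "x \<in> S" for x
  proof -
    have "x \<noteq> 0" using x assms(3) by metis
    then obtain y where "(y, x) \<in> set p" using pcas_enters[OF cas _ \<open>x \<noteq> 0\<close>] x assms(2) by blast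
    moreover from this arcs have "(y, x) \<in> parcs (star n)" by blast
    ultimately show ?thesis using \<open>x \<noteq> 0\<close> by auto
  qed
  moreover have "(x, 0) \<in> set p" if x: "x \<in> S" for x
  proof -
    have "x \<noteq> 0" using x assms(3) by metis
    then obtain y where "(x, y) \<in> set p" using pcas_leaves[OF cas _ \<open>x \<noteq> 0\<close>] x assms(2) by blast
    moreover from this arcs have "(x, y) \<in> parcs (star n)" by blast
    ultimately show ?thesis using \<open>x \<noteq> 0\<close> by auto
  qed
  ultimately have sub: "{0} \<times> S \<union> S \<times> {0} \<subseteq> set p" by auto
  have "card ({0} \<times> S \<union> S \<times> {0}) = card ({0::nat} \<times> S) + card (S \<times> {0::nat})"
    using fin assms(3) by (intro card_Un_disjoint) auto
  also have "\<dots> = 2 * card S" by (simp add: card_cartesian_product)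
  finally have "2 * card S \<le> card (set p)"
    using card_mono[OF _ sub] by simp
  with card_length[of p] show ?thesis by linarith
qed

section \<open>Distances in the star\<close>

text \<open>The graph metric of the star in closed form; \<open>shortest_dist_star\<close>
  identifies it with the shortest-path distance.\<close>

definition star_dist :: "nat \<Rightarrow> nat \<Rightarrow> nat" where
  "star_dist u v = (if u = v then 0 else if u = 0 \<or> v = 0 then 1 else 2)"

lemma length_walk_ge:
  assumes "star.awalk n u p v"
  shows "star_dist u v \<le> length p"
proof (cases p)
  case Nil
  with assms show ?thesis by (simp add: star.awalk_Nil_iff star_dist_def)
next
  case (Cons e p')
  show ?thesis
  proof (cases p')
    case Nil
    with Cons assms show ?thesis
      by (cases e) (auto simp: star.awalk_simps star_dist_def)
  next
    \<comment> \<open>No distance exceeds 2, so walks with at least two arcs satisfy the bound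
      trivially.\<close>
    case (Cons e' p'')
    with \<open>p = e # p'\<close> show ?thesis by (simp add: star_dist_def)
  qed
qed

lemma ex_walk_star_dist:
  assumes "u \<le> n" "v \<le> n"
  shows "\<exists>p. star.awalk n u p v \<and> length p = star_dist u v"
proof -
  consider "u = v" | "u \<noteq> v" "u = 0 \<or> v = 0" | "u \<noteq> v" "u \<noteq> 0" "v \<noteq> 0" by blast
  then show ?thesis
  proof cases
    case 1
    with assms show ?thesis by (intro exI[of _ "[]"]) (simp add: star.awalk_simps star_dist_def)
  next
    case 2
    with assms show ?thesis
      by (intro exI[of _ "[(u, v)]"]) (auto simp: star.awalk_simps star_dist_def)
  next
    case 3
    with assms show ?thesis
      by (intro exI[of _ "[(u, 0), (0, v)]"]) (auto simp: star.awalk_simps star_dist_def)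
  qed
qed

lemma shortest_dist_star:
  assumes "u \<le> n" "v \<le> n"
  shows "star.\<mu> n (\<lambda>_. 1) u v = ereal (real (star_dist u v))"
proof (rule antisym)
  obtain p where "star.awalk n u p v" "length p = star_dist u v"
    using ex_walk_star_dist[OF assms] by blast
  then show "star.\<mu> n (\<lambda>_. 1) u v \<le> ereal (real (star_dist u v))"
    using star.min_cost_le_walk_cost[of n u p v "\<lambda>_. 1"] by simp
  show "ereal (real (star_dist u v)) \<le> star.\<mu> n (\<lambda>_. 1) u v"
    unfolding star.\<mu>_def by (intro INF_greatest) (auto dest: length_walk_ge)
qed

lemma ext_len_star:
  assumes "u \<le> n" "v \<le> n"
  shows "ext_len (star_network kt kd \<alpha> n) u v = real (star_dist u v)"
  using assms by (auto simp: ext_len_def shortest_dist_star star_dist_def)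

lemma rdp_network_star:
  assumes "kt \<ge> 1" "kd \<ge> 1" "\<alpha> \<ge> 1" "n \<ge> 1"
  shows "rdp_network (star_network kt kd \<alpha> n)"
proof -
  have "connected (with_proj (star n))"
  proof (rule star.connectedI)
    fix u v assume "u \<in> pverts (star n)" "v \<in> pverts (star n)"
    then obtain p where "star.awalk n u p v" using ex_walk_star_dist[of u n v] by auto
    then have "reachable (with_proj (star n)) u v" using star.reachable_awalk by blast
    then show "reachable (with_proj (mk_symmetric (with_proj (star n)))) u v"
      by (rule star.reachable_mk_symmetricI)
  qed auto
  moreover have "{0..n} - {0} \<noteq> {}" using assms by auto
  moreover have "star_dist u w \<le> star_dist u v + star_dist v w" for u v w
    by (auto simp: star_dist_def)
  ultimately show ?thesis using assms star.pair_graph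
    by (auto simp: rdp_network_def ext_len_star simp flip: of_nat_add)
qed

section \<open>Walks along a given node sequence\<close>

lemma follows_star_length:
  assumes "follows (star_network kt kd \<alpha> n) (u # xs) p" "set (u # xs) \<subseteq> {0..n}"
  shows "length p = sum_list (map2 star_dist (u # xs) xs)"
  using assms
proof (induction xs arbitrary: u p)
  case (Cons v xs)
  then obtain q r where qr: "p = q @ r" "real (length q) = real (star_dist u v)"
      "follows (star_network kt kd \<alpha> n) (v # xs) r"
    by (auto simp: shortest_dist_star)
  with Cons.IH[OF qr(3)] Cons.prems show ?case by simp
qed simp

lemma sum_star_dist_le: "sum_list (map2 star_dist (u # xs) xs) \<le> 2 * length xs"
proof (induction xs arbitrary: u)
  case (Cons v xs)
  have "star_dist u v \<le> 2" by (simp add: star_dist_def)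
  with Cons[of v] show ?case by simp
qed simp

lemma sum_star_dist_snoc:
  "sum_list (map2 star_dist (u # xs @ [0]) (xs @ [0])) =
     sum_list (map2 star_dist (u # xs) xs) + star_dist (last (u # xs)) 0"
  by (induction xs arbitrary: u) auto

text \<open>The leg from the depot and the way back cost at most 1 each, every leg between clients
  at most 2. The way back is included because the truck's route stops at the last node of its
  segment and may be continued through the depot.\<close>

lemma follows_star_from_depot:
  assumes "follows (star_network kt kd \<alpha> n) (0 # xs) p" "set xs \<subseteq> {1..n}"
  shows "length p + star_dist (last (0 # xs)) 0 \<le> 2 * length xs"
proof (cases xs)
  case Nil
  with assms show ?thesis by (simp add: star_dist_def)
next
  case (Cons x ys)
  have "length p = star_dist 0 x + sum_list (map2 star_dist (x # ys) ys)"
    using follows_star_length[OF assms(1)] assms(2) Cons by force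
  moreover have "star_dist 0 x \<le> 1" "star_dist (last (0 # xs)) 0 \<le> 1"
    by (simp_all add: star_dist_def)
  ultimately show ?thesis using sum_star_dist_le[of x ys] Cons by simp
qed

lemma follows_star_tour:
  assumes "follows (star_network kt kd \<alpha> n) (0 # xs @ [0]) p" "set xs \<subseteq> {1..n}"
  shows "length p \<le> 2 * length xs"
proof (cases xs)
  case Nil
  with assms follows_star_length[OF assms(1)] show ?thesis by (simp add: star_dist_def)
next
  case (Cons x ys)
  have "length p = sum_list (map2 star_dist (0 # xs @ [0]) (xs @ [0]))"
    using follows_star_length[OF assms(1)] assms(2) by force
  also have "\<dots> = star_dist 0 x + sum_list (map2 star_dist (x # ys) ys)
      + star_dist (last (0 # xs)) 0"
    by (simp only: sum_star_dist_snoc) (simp add: Cons)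
  finally show ?thesis using sum_star_dist_le[of x ys] Cons
    by (simp add: star_dist_def split: if_splits)
qed

section \<open>Explicit tours and optimal makespans\<close>

text \<open>Successive trips from the depot to one client and back. For distinct clients this
  attains the bound of \<open>length_tour_ge\<close>.\<close>

definition star_tour :: "nat list \<Rightarrow> nat walk" where
  "star_tour xs = concat (map (\<lambda>x. [(0, x), (x, 0)]) xs)"

lemma length_star_tour [simp]: "length (star_tour xs) = 2 * length xs"
  by (induction xs) (auto simp: star_tour_def)

lemma star_tour_walk:
  assumes "set xs \<subseteq> {1..n}"
  shows "star.awalk n 0 (star_tour xs) 0"
  using assms by (induction xs) (auto simp: star_tour_def star.awalk_simps)

lemma verts_star_tour: "set (pawalk_verts 0 (star_tour xs)) = insert 0 (set xs)"
  by (induction xs) (auto simp: star_tour_def)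

text \<open>Since \<open>n \<le> kt * m\<close>, the clients can be split into \<open>kt\<close>
  blocks of at most \<open>m\<close>. Serving one block per truck has makespan at most
  \<open>2 * m\<close>, so no tour of an optimal family is longer.\<close>

lemma optimal_star_length:
  assumes "optimal_family (star_network kt kd \<alpha> n) kt 0 {1..n} ts []"
    and "kt \<ge> 1" "m \<ge> 1" "n \<le> kt * m" "p \<in> set ts"
  shows "length p \<le> 2 * m"
proof -
  let ?N = "star_network kt kd \<alpha> n"
  define ys where "ys = [1..<Suc n]"
  define ts' where "ts' = map (\<lambda>i. star_tour (take m (drop (i * m) ys))) [0..<kt]"
  have "{1..n} \<subseteq> visits ?N (ts' @ [])"
  proof
    fix x assume x: "x \<in> {1..n}"
    \<comment> \<open>Clients are numbered from 1 and list positions from 0, so client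
      \<open>x\<close> sits at position \<open>x - 1\<close>.\<close>
    then have j: "x - 1 < length ys" "ys ! (x - 1) = x" by (auto simp: ys_def nth_upt simp del: upt_Suc)
    have "x - 1 < kt * m" using x assms(4) by auto
    then have "(x - 1) div m < kt" by (simp add: less_mult_imp_div_less)
    moreover have "x \<in> set (take m (drop ((x - 1) div m * m) ys))"
      using nth_in_chunk[OF j(1) assms(3)] j(2) by simp
    ultimately show "x \<in> visits ?N (ts' @ [])"
      by (auto simp: visits_def ts'_def verts_star_tour)
  qed
  moreover have "star.awalk n 0 (star_tour (take m (drop (i * m) ys))) 0" for i
    using set_take_subset set_drop_subset by (intro star_tour_walk) (fastforce simp: ys_def)
  ultimately have "tour_family ?N kt 0 {1..n} ts' []"
    by (auto simp: tour_family_def ts'_def)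
  then have "makespan ?N ts [] \<le> makespan ?N ts' []"
    using assms(1) by (simp add: optimal_family_def)
  also have "\<dots> \<le> 2 * real m"
    using assms(2) by (intro makespan_le) (auto simp: ts'_def)
  finally have "real (length p) \<le> 2 * real m"
    using makespan_ge[OF assms(5), of ?N "[]"] by simp
  then show ?thesis by linarith
qed

text \<open>One client per truck and \<alpha> clients per drone exhaust the \<open>n\<close> clients
  within time 2. Conversely, some truck has to visit a damaged client, which takes it at least
  2.\<close>

lemma OPT_star:
  assumes "D \<subseteq> {1..n}" "D \<noteq> {}" "card D \<le> kt" "kt \<ge> 1" "\<alpha> \<ge> 1" "n = kt + \<alpha> * kd"
  shows "OPT (star_network kt kd \<alpha> n) D = 2"
proof -
  let ?N = "star_network kt kd \<alpha> n"
  have fin: "finite D" using assms(1) finite_subset by blast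
  \<comment> \<open>Damaged clients come first, so all of them are among the first \<open>kt\<close>
    entries, which go to the trucks.\<close>
  define ys where "ys = sorted_list_of_set D @ sorted_list_of_set ({1..n} - D)"
  have set_ys: "set ys = {1..n}" using fin assms(1) by (auto simp: ys_def)
  have len_ys: "length ys = n"
    using fin assms(1) card_mono[OF _ assms(1)] by (simp add: ys_def card_Diff_subset)
  define ts where "ts = map (\<lambda>i. star_tour [ys ! i]) [0..<kt]"
  \<comment> \<open>The remaining \<open>\<alpha> * kd\<close> clients form \<open>kd\<close> blocks
    of \<alpha> each. A block needs \<open>2 * \<alpha>\<close> arcs, hence time 2 at speed
    \<alpha>.\<close>
  define ds where "ds = map (\<lambda>j. star_tour (take \<alpha> (drop (j * \<alpha>) (drop kt ys)))) [0..<kd]"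
  have trucks: "visits ?N ts \<supseteq> {ys ! i | i. i < kt}"
    by (auto simp: visits_def ts_def verts_star_tour)
  have "D \<subseteq> visits ?N ts"
  proof
    fix x assume "x \<in> D"
    then obtain i where "i < card D" "sorted_list_of_set D ! i = x"
      using fin by (metis in_set_conv_nth set_sorted_list_of_set length_sorted_list_of_set)
    then have "i < kt" "ys ! i = x" using assms(3) by (auto simp: ys_def nth_append)
    then show "x \<in> visits ?N ts" using trucks by auto
  qed
  moreover have "{1..n} \<subseteq> visits ?N (ts @ ds)"
  proof
    fix x assume "x \<in> {1..n}"
    then obtain i where i: "i < n" "ys ! i = x"
      using set_ys len_ys by (metis in_set_conv_nth)
    show "x \<in> visits ?N (ts @ ds)"
    proof (cases "i < kt")
      case True
      with i trucks show ?thesis by (auto simp: visits_def)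
    next
      case False
      have j: "i - kt < length (drop kt ys)" "drop kt ys ! (i - kt) = x"
        using i False len_ys by auto
      have "i - kt < kd * \<alpha>" using i False assms(6) by (simp add: mult.commute)
      then have "(i - kt) div \<alpha> < kd" by (simp add: less_mult_imp_div_less)
      moreover have "x \<in> set (take \<alpha> (drop ((i - kt) div \<alpha> * \<alpha>) (drop kt ys)))"
        using nth_in_chunk[OF j(1) assms(5)] j(2) by simp
      ultimately show ?thesis
        unfolding visits_def ds_def by (force simp: verts_star_tour simp del: drop_drop)
    qed
  qed
  moreover have "is_tour ?N p" if p: "p \<in> set (ts @ ds)" for p
  proof -
    have "\<exists>xs. p = star_tour xs \<and> set xs \<subseteq> set ys"
    proof (cases "p \<in> set ts")
      case True
      then obtain i where "i < kt" "p = star_tour [ys ! i]" by (auto simp: ts_def)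
      moreover have "ys ! i \<in> set ys" using \<open>i < kt\<close> len_ys assms(6) by simp
      ultimately show ?thesis by auto
    next
      case False
      then obtain j where "p = star_tour (take \<alpha> (drop (j * \<alpha>) (drop kt ys)))"
        using p by (auto simp: ds_def simp del: drop_drop)
      then show ?thesis by (metis set_take_subset set_drop_subset order_trans)
    qed
    then show ?thesis using set_ys star_tour_walk by auto
  qed
  ultimately have fam: "tour_family ?N kt kd {1..n} ts ds" "D \<subseteq> visits ?N ts"
    by (auto simp: tour_family_def ts_def ds_def)
  have ge: "2 \<le> makespan ?N ts' ds'"
    if family: "tour_family ?N kt kd {1..n} ts' ds'" and D: "D \<subseteq> visits ?N ts'" for ts' ds'
  proof -
    from assms(2) obtain x where x: "x \<in> D" by blast
    then obtain p where p: "p \<in> set ts'" "x \<in> set (pawalk_verts 0 p)"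
      using D by (auto simp: visits_def)
    have "star.awalk n 0 p 0" using family p(1) by (auto simp: tour_family_def)
    then have "2 * card {x} \<le> length p"
      using p(2) x assms(1) by (intro length_tour_ge) auto
    then have "2 \<le> cost ?N p" by simp
    also have "\<dots> \<le> makespan ?N ts' ds'" using p(1) by (rule makespan_ge)
    finally show ?thesis .
  qed
  have "makespan ?N ts ds \<le> 2"
    using assms(4,5) by (intro makespan_le) (auto simp: ts_def ds_def divide_le_eq)
  with ge[OF fam] have eq: "makespan ?N ts ds = 2" by simp
  \<comment> \<open>\<open>LEAST\<close> over the reals is evaluated by showing that 2 is attained
    and is a lower bound.\<close>
  show ?thesis unfolding OPT_def clients_star unfolding star_network_simps
  proof (rule Least_equality)
    show "\<exists>ts ds. tour_family ?N kt kd {1..n} ts ds \<and> D \<subseteq> visits ?N ts \<and> 2 = makespan ?N ts ds"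
      using fam eq by metis
  qed (use ge in blast)
qed

section \<open>First stage of Regretless on the star\<close>

text \<open>The policy is arbitrary, so the results hold however ties between optimal choices are
  broken. The number \<open>n\<close> of clients is fixed only in the final theorem.\<close>

locale star_policy =
  fixes kt kd \<alpha> n :: nat and R :: "nat policy"
  assumes kt: "kt \<ge> 1" and kd: "kd \<ge> 1" and \<alpha>: "\<alpha> \<ge> 1" and n: "n \<ge> 1"
    and policy: "regretless_policy R"
begin

abbreviation N :: "nat network" where "N \<equiv> star_network kt kd \<alpha> n"
abbreviation P :: "nat plan" where "P \<equiv> plan_of R N"
abbreviation seg :: "nat \<Rightarrow> nat list" where "seg i \<equiv> truck_segment (segments P i)"

lemma first_stage: "first_stage_plan N P"
  using policy rdp_network_star[OF kt kd \<alpha> n] by (simp add: regretless_policy_def)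

lemma all_listings:
  "distinct (concat (map (listing P) [0..<kt]))"
  "set (concat (map (listing P) [0..<kt])) = {1..n}"
  using first_stage clients_star by (auto simp: first_stage_plan_def Let_def)

lemma distinct_listing: "i < kt \<Longrightarrow> distinct (listing P i)"
  using all_listings(1) by (auto simp: distinct_concat_iff)

lemma listing_subset: "i < kt \<Longrightarrow> set (listing P i) \<subseteq> {1..n}"
  using all_listings(2) by auto

lemma sum_listings: "length (concat (map (listing P) [0..<kt])) = n"
  using distinct_card[OF all_listings(1)] all_listings(2) by simp

lemma plan_facts:
  assumes "i < kt"
  shows "follows N (0 # listing P i @ [0]) (base_tours P ! i)"
    and "splitting (listing P i) (1 + drone_count P i) (segments P i)"
    and "follows N (0 # seg i) (truck_route P i)"
    and "list_all2 (\<lambda>s p. follows N (0 # rev s @ [0]) p)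
           (drone_segments (segments P i)) (drone_routes P i)"
  using first_stage assms by (auto simp: first_stage_plan_def optimal_splitting_def)

lemma listing_split:
  assumes "i < kt"
  shows "listing P i = seg i @ concat (drone_segments (segments P i))"
  using plan_facts(2)[OF assms]
  by (cases "segments P i") (auto simp: splitting_def truck_segment_def drone_segments_def)

text \<open>Segments are nonempty and the first one belongs to the truck. Hence the first client is
  the truck's under every splitting, and no other knowledge of the splitting is needed.\<close>

lemma hd_listing_in_seg:
  assumes "i < kt" "listing P i \<noteq> []"
  shows "hd (listing P i) \<in> set (seg i)"
proof (cases "segments P i")
  case Nil
  then show ?thesis using plan_facts(2)[OF assms(1)] assms(2) by (simp add: splitting_def)
next
  case (Cons s ss)
  then have "seg i \<noteq> []"
    using plan_facts(2)[OF assms(1)] by (auto simp: splitting_def truck_segment_def)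
  then show ?thesis by (simp add: listing_split[OF assms(1)])
qed

text \<open>The base tour has length at most \<open>2 * m\<close> by optimality, while each of its
  distinct listed clients costs it two arcs.\<close>

lemma listing_length_le:
  assumes "i < kt" "m \<ge> 1" "n \<le> kt * m"
  shows "length (listing P i) \<le> m"
proof -
  have opt: "optimal_family N kt 0 {1..n} (base_tours P) []"
    using first_stage clients_star by (simp add: first_stage_plan_def)
  then have "base_tours P ! i \<in> set (base_tours P)"
    using assms(1) by (auto simp: optimal_family_def tour_family_def)
  then have "length (base_tours P ! i) \<le> 2 * m"
    using optimal_star_length[OF opt kt assms(2,3)] by blast
  moreover have "2 * card (set (listing P i)) \<le> length (base_tours P ! i)"
    using follows_walk[of N 0 "listing P i @ [0]" "base_tours P ! i"] plan_facts(1)[OF assms(1)]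
      listing_subset[OF assms(1)] star.pair_wf_digraph
    by (intro length_tour_ge) auto
  ultimately show ?thesis using distinct_card[OF distinct_listing[OF assms(1)]] by simp
qed

text \<open>A drone serves a part of the listing, at a cost of at most two arcs per client.\<close>

lemma drone_route_length:
  assumes "i < kt" "p \<in> set (drone_routes P i)"
  shows "length p \<le> 2 * length (listing P i)"
proof -
  obtain k where k: "k < length (drone_routes P i)" "p = drone_routes P i ! k"
    using assms(2) by (auto simp: in_set_conv_nth)
  obtain s where s: "s \<in> set (drone_segments (segments P i))" "follows N (0 # rev s @ [0]) p"
    using plan_facts(4)[OF assms(1)] k that[of "drone_segments (segments P i) ! k"]
    by (simp add: list_all2_conv_all_nth)
  have sub: "set s \<subseteq> {1..n}"
    using s(1) listing_split[OF assms(1)] listing_subset[OF assms(1)] by auto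
  have "length s \<le> length (concat (drone_segments (segments P i)))"
    using s(1) by (auto simp: length_concat intro: member_le_sum_list)
  also have "\<dots> \<le> length (listing P i)" by (simp add: listing_split[OF assms(1)])
  finally have "length s \<le> length (listing P i)" .
  moreover have "length p \<le> 2 * length s" using follows_star_tour[OF s(2)] sub by simp
  ultimately show ?thesis by linarith
qed

lemma seg_subset: "i < kt \<Longrightarrow> set (seg i) \<subseteq> {1..n}"
  using listing_subset[of i] by (simp add: listing_split)

lemma truck_route_walk:
  assumes "i < kt"
  shows "star.awalk n 0 (truck_route P i) (replan_node R N i)"
    and "set (seg i) \<subseteq> set (pawalk_verts 0 (truck_route P i))"
    and "replan_node R N i \<le> n"
proof -
  show walk: "star.awalk n 0 (truck_route P i) (replan_node R N i)"
    and "set (seg i) \<subseteq> set (pawalk_verts 0 (truck_route P i))"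
    using follows_walk[of N 0 "seg i" "truck_route P i"] plan_facts(3)[OF assms]
      star.pair_wf_digraph by (auto simp: replan_node_def)
  then show "replan_node R N i \<le> n" using star.awalk_last_in_verts[OF walk] by simp
qed

section \<open>Second stage for a given damage set\<close>

context
  fixes D
  assumes D: "D \<subseteq> {1..n}"
begin

lemma return_of_shortest:
  assumes "i < kt"
  shows "shortest_return_walk N (replan_node R N i) (open_damaged R N D i \<union> open_clients R N D i)
           (return_of R N D i)"
proof -
  have "rdp_instance N D"
    using rdp_network_star[OF kt kd \<alpha> n] D clients_star by (simp add: rdp_instance_def)
  moreover have "i < trucks N" using assms by simp
  ultimately show ?thesis using policy unfolding regretless_policy_def by blast
qed

lemma truck_walk_tour:
  assumes "i < kt"
  shows "star.awalk n 0 (truck_walk R N D i) 0"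
    and "set (pawalk_verts 0 (truck_walk R N D i)) =
         set (pawalk_verts 0 (truck_route P i)) \<union>
         set (pawalk_verts (replan_node R N i) (return_of R N D i))"
proof -
  have "star.awalk n (replan_node R N i) (return_of R N D i) 0"
    using return_of_shortest[OF assms] by (simp add: shortest_return_walk_def return_walk_def)
  with truck_route_walk(1)[OF assms]
  show "star.awalk n 0 (truck_walk R N D i) 0"
    and "set (pawalk_verts 0 (truck_walk R N D i)) =
         set (pawalk_verts 0 (truck_route P i)) \<union>
         set (pawalk_verts (replan_node R N i) (return_of R N D i))"
    unfolding truck_walk_def by (rule star.awalk_appendI, rule star.set_awalk_verts_append)
qed

text \<open>The truck's route is a prefix of its whole walk, and its cost is by definition the
  replanning time. So every node on this prefix has been reached by then.\<close>

lemma seg_reached: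
  assumes "i < kt"
  shows "set (seg i) \<subseteq> reached N 1 (truck_walk R N D i) (replan_time R N i)"
proof
  fix x assume "x \<in> set (seg i)"
  then have "x \<in> set (pawalk_verts 0 (truck_route P i))"
    using truck_route_walk(2)[OF assms] by blast
  then obtain j where j: "j < length (pawalk_verts 0 (truck_route P i))"
      "pawalk_verts 0 (truck_route P i) ! j = x"
    by (metis in_set_conv_nth)
  have "j \<le> length (truck_route P i)" using j(1) by (simp add: star.length_awalk_verts)
  moreover have "pawalk_verts 0 (truck_walk R N D i) ! j = x"
    using star.awalk_verts_append[of n 0 "truck_route P i" "return_of R N D i" 0]
      truck_walk_tour(1)[OF assms] j by (simp add: truck_walk_def nth_append)
  ultimately show "x \<in> reached N 1 (truck_walk R N D i) (replan_time R N i)"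
    by (auto simp: reached_def replan_time_def truck_walk_def intro!: exI[of _ j])
qed

lemma reached_subset:
  "reached N s (truck_walk R N D i) t \<subseteq> set (pawalk_verts 0 (truck_walk R N D i))"
  by (auto simp: reached_def star.length_awalk_verts intro!: nth_mem)

text \<open>
  Going back to the depot and then serving the remaining clients one by one is a feasible
  return walk.
\<close>

lemma truck_walk_length_le:
  assumes "i < kt"
  shows "length (truck_walk R N D i) \<le> 2 * length (listing P i)"
proof -
  let ?u = "replan_node R N i" and ?rest = "concat (drone_segments (segments P i))"
  let ?X = "open_damaged R N D i \<union> open_clients R N D i"
  obtain b where b: "star.awalk n ?u b 0" "length b = star_dist ?u 0"
    using ex_walk_star_dist[OF truck_route_walk(3)[OF assms]] by blast
  have "set ?rest \<subseteq> {1..n}"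
    using listing_split[OF assms] listing_subset[OF assms] by auto
  then have tour: "star.awalk n 0 (star_tour ?rest) 0" by (rule star_tour_walk)
  have "reached N 1 (truck_walk R N D i) t \<subseteq> reached_by_any R N D t" for t
    using assms by (auto simp: reached_by_any_def)
  \<comment> \<open>Whatever is still open at replanning lies outside the truck's segment, by
    \<open>seg_reached\<close>.\<close>
  then have "?X \<subseteq> set ?rest"
    using seg_reached[OF assms] listing_split[OF assms]
    by (fastforce simp: open_damaged_def open_clients_def)
  moreover have "set (pawalk_verts ?u (b @ star_tour ?rest)) \<supseteq> set ?rest"
    using star.set_awalk_verts_append[OF b(1) tour] by (auto simp: verts_star_tour)
  ultimately have "return_walk N ?u ?X (b @ star_tour ?rest)"
    using star.awalk_appendI[OF b(1) tour] by (auto simp: return_walk_def)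
  then have "cost N (return_of R N D i) \<le> cost N (b @ star_tour ?rest)"
    using return_of_shortest[OF assms] unfolding shortest_return_walk_def by blast
  then have "length (return_of R N D i) \<le> star_dist ?u 0 + 2 * length ?rest"
    using b(2) by simp
  \<comment> \<open>This bound already pays for the way from \<open>?u\<close> to the depot, so the
    sum with the previous one leaves two arcs per listed client.\<close>
  moreover have "length (truck_route P i) + star_dist ?u 0 \<le> 2 * length (seg i)"
    using follows_star_from_depot[OF plan_facts(3)[OF assms] seg_subset[OF assms]]
    by (simp add: replan_node_def)
  moreover have "length (listing P i) = length (seg i) + length ?rest"
    using arg_cong[OF listing_split[OF assms], of length] by simp
  ultimately show ?thesis by (simp add: truck_walk_def)
qed

text \<open>The truck visits every client of its listing: those of its segment in the first stage,
  and the others because they are damaged, so that a visit by a drone does not remove them from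
  \<open>open_damaged\<close>. Each visit costs two arcs by \<open>length_tour_ge\<close>.\<close>

lemma truck_walk_length_ge:
  assumes "i < kt" "set (tl (listing P i)) \<subseteq> D"
  shows "2 * length (listing P i) \<le> length (truck_walk R N D i)"
proof -
  let ?V = "set (pawalk_verts 0 (truck_walk R N D i))"
  have "x \<in> ?V" if x: "x \<in> set (listing P i)" for x
  proof (cases "x \<in> set (seg i)")
    case True
    then show ?thesis using truck_route_walk(2)[OF assms(1)] truck_walk_tour(2)[OF assms(1)] by blast
  next
    case False
    \<comment> \<open>The only client of the listing that may be undamaged is the first, and it lies
      in the truck's segment.\<close>
    then have "x \<noteq> hd (listing P i)"
      using hd_listing_in_seg[OF assms(1)] x by (cases "listing P i = []") auto
    then have "x \<in> D" using x assms(2) by (cases "listing P i") auto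
    show ?thesis
    proof (cases "x \<in> reached N 1 (truck_walk R N D i) (replan_time R N i)")
      case True
      then show ?thesis using reached_subset by blast
    next
      case False
      then have "x \<in> open_damaged R N D i" using \<open>x \<in> D\<close> x by (simp add: open_damaged_def)
      then show ?thesis
        using return_of_shortest[OF assms(1)] truck_walk_tour(2)[OF assms(1)]
        by (auto simp: shortest_return_walk_def return_walk_def)
    qed
  qed
  then have "2 * card (set (listing P i)) \<le> length (truck_walk R N D i)"
    using listing_subset[OF assms(1)]
    by (intro length_tour_ge[OF truck_walk_tour(1)[OF assms(1)]]) auto
  then show ?thesis using distinct_card[OF distinct_listing[OF assms(1)]] by simp
qed

text \<open>Truck \<open>i\<close> needs at least \<open>2 * m\<close>. No other truck needs more,
  and neither does a drone, whose speed is at least 1.\<close>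

lemma Regretless_star:
  assumes "i < kt" "length (listing P i) = m" "set (tl (listing P i)) \<subseteq> D"
    and "\<And>j. j < kt \<Longrightarrow> length (listing P j) \<le> m"
  shows "Regretless R N D = 2 * real m"
proof (rule antisym)
  have truck: "length (truck_walk R N D j) \<le> 2 * m" if "j < kt" for j
    using truck_walk_length_le[OF that] assms(4)[OF that] by linarith
  have drone: "real (length p) / real \<alpha> \<le> 2 * real m"
    if p: "p \<in> set (drone_routes P j)" and j: "j < kt" for p j
  proof -
    have "length p \<le> 2 * m" using drone_route_length[OF j p] assms(4)[OF j] by linarith
    then have "real (length p) \<le> 2 * real m" by linarith
    also have "\<dots> \<le> 2 * real m * real \<alpha>" using \<alpha> by (simp add: mult_le_cancel_left1)
    finally show ?thesis using \<alpha> by (simp add: divide_le_eq)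
  qed
  have "real (length (truck_walk R N D j)) \<le> 2 * real m" if "j < kt" for j
    using truck[OF that] by linarith
  then show "Regretless R N D \<le> 2 * real m"
    unfolding Regretless_def using kt drone by (intro makespan_le) auto
  have "2 * real m \<le> cost N (truck_walk R N D i)"
    using truck_walk_length_ge[OF assms(1,3)] assms(2) by simp
  also have "\<dots> \<le> Regretless R N D"
    unfolding Regretless_def using assms(1) by (intro makespan_ge) auto
  finally show "2 * real m \<le> Regretless R N D" .
qed

end

end

section \<open>Choice of the instance and the resulting ratio\<close>

theorem lemma23:
  fixes \<alpha> kt kd :: nat and R :: "nat policy"
  assumes "\<alpha> \<ge> 1" and "kt \<ge> 1" and "kd \<ge> 1"
    and "int kt \<ge> \<lceil>real (\<alpha> * kd) / real kt\<rceil>"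
    and "regretless_policy R"
  shows "\<exists>N D. rdp_instance N D \<and> trucks N = kt \<and> drones N = kd \<and> speed N = real \<alpha> \<and>
           Regretless R N D / OPT N D = 1 + real_of_int \<lceil>real (\<alpha> * kd) / real kt\<rceil>"
proof -
  define n where "n = kt + \<alpha> * kd"
  define q where "q = nat \<lceil>real (\<alpha> * kd) / real kt\<rceil>"
  have pos: "real (\<alpha> * kd) / real kt > 0" using assms by simp
  then have ceil: "\<lceil>real (\<alpha> * kd) / real kt\<rceil> = int q" "q \<ge> 1"
    unfolding q_def by linarith+
  have "real (\<alpha> * kd) / real kt \<le> real q" "real q < real (\<alpha> * kd) / real kt + 1"
    using ceil(1) by linarith+
  then have "real (\<alpha> * kd) \<le> real q * real kt" "real q * real kt < real (\<alpha> * kd) + real kt"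
    using assms(2) by (simp_all add: field_simps)
  then have "real (\<alpha> * kd) \<le> real (q * kt)" "real (q * kt) < real (\<alpha> * kd + kt)" by simp_all
  then have "\<alpha> * kd \<le> q * kt" "q * kt < \<alpha> * kd + kt" unfolding of_nat_le_iff of_nat_less_iff .
  \<comment> \<open>These two bounds encode that \<open>q\<close> is the ceiling: the first limits
    every listing to \<open>1 + q\<close> clients, the second excludes that all listings have at
    most \<open>q\<close>.\<close>
  then have n_bounds: "n \<le> kt * (1 + q)" "kt * q < n" by (simp_all add: n_def mult.commute)
  have "q \<le> kt" using assms(4) ceil(1) by simp

  interpret star_policy kt kd \<alpha> n R
    using assms by unfold_locales (auto simp: n_def)
  have le: "length (listing P j) \<le> 1 + q" if "j < kt" for j
    using listing_length_le[OF that _ n_bounds(1)] by simp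
  have "\<not> (\<forall>i<kt. length (listing P i) \<le> q)"
    using length_concat_map_le[of kt "listing P" q] sum_listings n_bounds(2) by auto
  then obtain i where i: "i < kt" "length (listing P i) = 1 + q"
    using le by (metis Suc_eq_plus1 add.commute le_antisym not_less_eq_eq)
  \<comment> \<open>The damage set depends on the policy through its first-stage plan. There is no
    circularity, as \<open>plan_of R\<close> is a function of the network alone.\<close>
  define D where "D = set (tl (listing P i))"
  have D: "D \<subseteq> {1..n}" "D \<noteq> {}" "card D \<le> kt"
  proof -
    show "D \<subseteq> {1..n}"
      using listing_subset[OF i(1)] i(2) by (cases "listing P i") (auto simp: D_def)
    have len: "length (tl (listing P i)) = q" using i(2) by simp
    show "D \<noteq> {}" using len ceil(2) by (cases "tl (listing P i)") (auto simp: D_def)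
    show "card D \<le> kt" using len \<open>q \<le> kt\<close> card_length[of "tl (listing P i)"] by (simp add: D_def)
  qed
  have "rdp_instance N D"
    using D(1) rdp_network_star[OF kt kd \<alpha> n] clients_star by (simp add: rdp_instance_def)
  moreover have "OPT N D = 2"
    using OPT_star[OF D kt \<alpha> n_def] .
  moreover have "Regretless R N D = 2 * real (1 + q)"
    using Regretless_star[OF D(1) i _ le] by (simp add: D_def)
  ultimately show ?thesis
    using ceil(1) by (intro exI[of _ N] exI[of _ D]) simp
qed

end
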